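(* Let $H$ be a real Hilbert space, $E:H\to H$ a bounded linear positive definite operator, $\lambda>0$, and $\mathcal{M}:H\rightrightarrows H$ a maximal monotone operator. Then $$(\mathcal{M}^{-1}+\lambda E)^{-1}=\frac1\lambda E^{-1}\big(I-J_{\lambda E\mathcal{M}}\big).$$
   Context: A bounded linear $E:H\to H$ is positive definite ($E\succ0$) if there is $c>0$ with $\langle Ex,x\rangle\ge c\|x\|^2$ for all $x\in H$ (self-adjointness is not part of the definition). $E\mathcal{M}$ is the operator $x\mapsto\{Eu:u\in\mathcal{M}(x)\}$, which need not be monotone, and $J_{\lambda E\mathcal{M}}:=(I+\lambda E\mathcal{M})^{-1}$. Inverses of set-valued operators are inverses of graphs: $\mathcal{M}^{-1}(y)=\{x: y\in\mathcal{M}(x)\}$. Both sides of the identity are single-valued operators on $H$. *)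

theory Defs
  imports "HOL-Analysis.Analysis"
begin

text \<open>
  A set-valued operator \<open>H \<rightrightarrows> H\<close> is a function \<open>'a \<Rightarrow> 'a set\<close>; single-valued maps enter
  via \<open>op_of\<close>. All operations below act on graphs, so no value is ever chosen arbitrarily.
  The arithmetic of values is spelled out since \<open>-\<close> on type \<open>set\<close> is set difference.
\<close>

type_synonym 'a setop = "'a \<Rightarrow> 'a set"

definition op_of :: "('a \<Rightarrow> 'a) \<Rightarrow> 'a setop" where
  "op_of f = (\<lambda>x. {f x})"

definition op_inv :: "'a setop \<Rightarrow> 'a setop" where
  "op_inv A = (\<lambda>y. {x. y \<in> A x})"

definition op_comp :: "'a setop \<Rightarrow> 'a setop \<Rightarrow> 'a setop" where
  "op_comp A B = (\<lambda>x. \<Union>u\<in>B x. A u)"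

definition op_plus :: "'a::real_vector setop \<Rightarrow> 'a setop \<Rightarrow> 'a setop" where
  "op_plus A B = (\<lambda>x. {u + v | u v. u \<in> A x \<and> v \<in> B x})"

definition op_minus :: "'a::real_vector setop \<Rightarrow> 'a setop \<Rightarrow> 'a setop" where
  "op_minus A B = (\<lambda>x. {u - v | u v. u \<in> A x \<and> v \<in> B x})"

definition op_scale :: "real \<Rightarrow> 'a::real_vector setop \<Rightarrow> 'a setop" where
  "op_scale r A = (\<lambda>x. {r *\<^sub>R u | u. u \<in> A x})"

definition op_single_valued :: "'a setop \<Rightarrow> bool" where
  \<comment> \<open>exactly one value at every point; in particular the domain is the whole space\<close>
  "op_single_valued A \<longleftrightarrow> (\<forall>x. \<exists>!u. u \<in> A x)"

definition monotone_op :: "'a::real_inner setop \<Rightarrow> bool" where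
  "monotone_op M \<longleftrightarrow> (\<forall>x y. \<forall>u\<in>M x. \<forall>v\<in>M y. 0 \<le> inner (x - y) (u - v))"

definition maximal_monotone :: "'a::real_inner setop \<Rightarrow> bool" where
  "maximal_monotone M \<longleftrightarrow>
     monotone_op M \<and> (\<forall>N. monotone_op N \<and> (\<forall>x. M x \<subseteq> N x) \<longrightarrow> N = M)"

definition positive_definite :: "('a::real_inner \<Rightarrow> 'a) \<Rightarrow> bool" where
  \<comment> \<open>self-adjointness is not required\<close>
  "positive_definite E \<longleftrightarrow> (\<exists>c>0. \<forall>x. inner (E x) x \<ge> c * (norm x)\<^sup>2)"

definition resolvent :: "'a::real_vector setop \<Rightarrow> 'a setop" where
  "resolvent A = op_inv (op_plus (op_of id) A)"

end

theory Submission
  imports Defs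
begin

text \<open>
  Write \<open>B = \<lambda>E\<close>. Unfolding graphs, \<open>u\<close> belongs to the left-hand side at \<open>x\<close> exactly when
  \<open>u \<in> M (x - B u)\<close>. On the right, \<open>p\<close> is a resolvent value at \<open>x\<close> exactly when \<open>x - p = \<lambda>E u\<close> for
  some \<open>u \<in> M p\<close>, and since a positive definite \<open>E\<close> is injective, \<open>(1/\<lambda>) E\<^sup>-\<^sup>1 (x - p)\<close> recovers that very
  \<open>u\<close>. So the identity of graphs is elementary, and the content is that the inclusion
  \<open>u \<in> M (x - B u)\<close> has exactly one solution for every \<open>x\<close>. Uniqueness
  (\<open>inclusion_unique\<close>) follows by playing the monotonicity of \<open>M\<close> against the coercivity of \<open>B\<close>.

  Existence (\<open>inclusion_solvable\<close>) is Minty's surjectivity theorem with \<open>B\<close> in place of the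
  identity. As \<open>B\<close> need not be self-adjoint, it cannot be absorbed into the inner product.
  Instead, for large \<open>t\<close> the map \<open>t I - B\<close> has norm strictly less than \<open>t\<close>, whereas the map sending \<open>w\<close>
  to the solution \<open>u\<close> of \<open>u \<in> M (w - t u)\<close> is \<open>1/t\<close>-Lipschitz. The inclusion is
  the fixed point equation of the composition of the two (with \<open>w = x + t u - B u\<close>), so Banach's
  theorem solves it.

  That leaves the case \<open>B = t I\<close>, which an affine change of variables reduces to finding \<open>x\<close> with
  \<open>- x \<in> M x\<close> (\<open>minty_antidiagonal\<close>). The proof is variational, through the Fitzpatrick
  function \<open>F (x, v) = sup {\<langle>x, u\<rangle> + \<langle>a, v\<rangle> - \<langle>a, u\<rangle> | u \<in> M a}\<close>. It is convex and lower semicontinuous,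
  maximality gives \<open>F (x, v) \<ge> \<langle>x, v\<rangle>\<close>, and equality holds on the graph of \<open>M\<close>. Hence
  \<open>F + \<parallel>\<cdot>\<parallel>\<^sup>2/2\<close> is bounded below and, being strongly convex, attains its minimum at some \<open>(p, q)\<close>.
  The first-order condition there, tested on the graph, says that \<open>(-q, -p)\<close> is monotonically
  related to the graph with a margin of \<open>\<parallel>p + q\<parallel>\<^sup>2\<close>. By maximality that point lies on the graph itself, so the
  margin is zero and \<open>- p \<in> M p\<close>.
\<close>

section \<open>Minimising a convex function plus half the squared norm\<close>

text \<open>
  The set \<open>K\<close> plays the role of an epigraph, so that an extended-valued convex function can be
  minimised without leaving the reals. By the parallelogram law, the midpoint of two
  near-minimisers would beat the infimum unless they are close together; hence every minimising
  sequence is Cauchy.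
\<close>

lemma strongly_convex_minimizer_exists:
  fixes K :: "('b::{real_inner, complete_space} \<times> real) set"
  assumes conv: "convex K" and clo: "closed K" and ne: "K \<noteq> {}"
    and bdd: "\<And>z r. (z, r) \<in> K \<Longrightarrow> b \<le> r + (norm z)\<^sup>2 / 2"
  obtains p s where "(p, s) \<in> K"
    "\<And>z r. (z, r) \<in> K \<Longrightarrow> s + (norm p)\<^sup>2 / 2 \<le> r + (norm z)\<^sup>2 / 2"
proof -
  define \<phi> where "\<phi> = (\<lambda>k :: 'b \<times> real. snd k + (norm (fst k))\<^sup>2 / 2)"
  define m where "m = Inf (\<phi> ` K)"
  have bb: "bdd_below (\<phi> ` K)"
    using bdd unfolding \<phi>_def by (intro bdd_belowI2[where m = b]) auto
  have low: "m \<le> \<phi> k" if "k \<in> K" for k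
    unfolding m_def using that bb by (intro cInf_lower) auto
  have "\<exists>k\<in>K. \<phi> k < m + 1 / real (Suc n)" for n
    using cInf_lessD[of "\<phi> ` K" "m + 1 / real (Suc n)"] ne unfolding m_def by auto
  then obtain k where kK: "\<And>n. k n \<in> K" and k_lt: "\<And>n. \<phi> (k n) < m + 1 / real (Suc n)"
    by metis
  define z r where "z = (\<lambda>n. fst (k n))" and "r = (\<lambda>n. snd (k n))"
  have near: "(norm (z i - z j))\<^sup>2 \<le> 4 * (1 / real (Suc i) + 1 / real (Suc j))" for i j
  proof -
    have "(1 / 2) *\<^sub>R k i + (1 / 2) *\<^sub>R k j \<in> K"
      using conv kK by (intro convexD) auto
    from low[OF this]
    have "m \<le> (r i + r j) / 2 + (norm ((1 / 2) *\<^sub>R (z i + z j)))\<^sup>2 / 2"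
      by (simp add: \<phi>_def z_def r_def scaleR_add_right add_divide_distrib)
    moreover have "(norm ((1 / 2) *\<^sub>R (z i + z j)))\<^sup>2
        = (norm (z i))\<^sup>2 / 2 + (norm (z j))\<^sup>2 / 2 - (norm (z i - z j))\<^sup>2 / 4"
      by (simp add: power2_norm_eq_inner inner_add_left inner_add_right inner_diff_left
          inner_diff_right inner_commute field_simps)
    moreover have "r i + (norm (z i))\<^sup>2 / 2 < m + 1 / real (Suc i)"
      "r j + (norm (z j))\<^sup>2 / 2 < m + 1 / real (Suc j)"
      using k_lt[of i] k_lt[of j] unfolding \<phi>_def z_def r_def by blast+
    ultimately show ?thesis by argo
  qed
  have "Cauchy z"
  proof (rule metric_CauchyI)
    fix e :: real assume e: "e > 0"
    then obtain N where N: "1 / real (Suc N) < e\<^sup>2 / 8"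
      using reals_Archimedean[of "e\<^sup>2 / 8"] by (auto simp: inverse_eq_divide)
    have "dist (z i) (z j) < e" if "i \<ge> N" "j \<ge> N" for i j
    proof -
      have "1 / real (Suc i) \<le> 1 / real (Suc N)" "1 / real (Suc j) \<le> 1 / real (Suc N)"
        using that by (auto simp: frac_le)
      then have "(norm (z i - z j))\<^sup>2 < e\<^sup>2"
        using near[of i j] N by argo
      then show ?thesis
        using e by (simp add: dist_norm power_less_imp_less_base)
    qed
    then show "\<exists>N. \<forall>i\<ge>N. \<forall>j\<ge>N. dist (z i) (z j) < e" by blast
  qed
  then obtain p where p: "z \<longlonglongrightarrow> p"
    using Cauchy_convergent convergent_def by blast
  have \<phi>_lim: "(\<lambda>n. \<phi> (k n)) \<longlonglongrightarrow> m"
  proof (rule tendsto_sandwich[of "\<lambda>_. m"])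
    have "(\<lambda>n. m + inverse (real (Suc n))) \<longlonglongrightarrow> m + 0"
      by (intro tendsto_intros LIMSEQ_inverse_real_of_nat)
    then show "(\<lambda>n. m + 1 / real (Suc n)) \<longlonglongrightarrow> m"
      by (simp add: inverse_eq_divide)
  qed (use low kK k_lt in \<open>auto intro!: always_eventually less_imp_le\<close>)
  define s where "s = m - (norm p)\<^sup>2 / 2"
  have "(\<lambda>n. \<phi> (k n) - (norm (z n))\<^sup>2 / 2) \<longlonglongrightarrow> s"
    unfolding s_def by (intro tendsto_intros \<phi>_lim p) auto
  then have "r \<longlonglongrightarrow> s" by (simp add: \<phi>_def z_def r_def)
  with p have "(\<lambda>n. (z n, r n)) \<longlonglongrightarrow> (p, s)" by (rule tendsto_Pair)
  then have "(p, s) \<in> K"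
    using clo kK by (rule_tac closed_sequentially[of K "\<lambda>n. (z n, r n)"]) (auto simp: z_def r_def)
  moreover have "s + (norm p)\<^sup>2 / 2 \<le> r' + (norm z')\<^sup>2 / 2" if "(z', r') \<in> K" for z' r'
    using low[OF that] by (simp add: s_def \<phi>_def)
  ultimately show thesis by (rule that)
qed

text \<open>
  The first-order condition at a minimiser: move a distance \<open>t\<close> along the segment towards a
  competitor, divide by \<open>t\<close> and let \<open>t\<close> tend to zero, so that the quadratic term disappears.
\<close>

lemma minimizer_variational_inequality:
  fixes K :: "('b::real_inner \<times> real) set"
  assumes conv: "convex K" and ps: "(p, s) \<in> K" and zr: "(z, r) \<in> K"
    and min: "\<And>z r. (z, r) \<in> K \<Longrightarrow> s + (norm p)\<^sup>2 / 2 \<le> r + (norm z)\<^sup>2 / 2"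
  shows "s \<le> r + inner p (z - p)"
proof -
  have slope: "0 \<le> r - s + inner p (z - p) + t * ((norm (z - p))\<^sup>2 / 2)"
    if t: "t \<in> {0<..<1}" for t :: real
  proof -
    have "(1 - t) *\<^sub>R (p, s) + t *\<^sub>R (z, r) \<in> K"
      using conv ps zr t by (intro convexD) auto
    moreover have "(1 - t) *\<^sub>R (p, s) + t *\<^sub>R (z, r) = (p + t *\<^sub>R (z - p), s + t * (r - s))"
      by (simp add: algebra_simps)
    ultimately have "s + (norm p)\<^sup>2 / 2 \<le> s + t * (r - s) + (norm (p + t *\<^sub>R (z - p)))\<^sup>2 / 2"
      using min by metis
    moreover have "(norm (p + t *\<^sub>R (z - p)))\<^sup>2
        = (norm p)\<^sup>2 + 2 * t * inner p (z - p) + t\<^sup>2 * (norm (z - p))\<^sup>2"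
      by (simp only: power2_norm_eq_inner inner_add_left inner_add_right inner_scaleR_left
          inner_scaleR_right inner_commute[of "z - p" p]) (simp add: power2_eq_square algebra_simps)
    ultimately have "0 \<le> t * (r - s + inner p (z - p) + t * ((norm (z - p))\<^sup>2 / 2))"
      by (simp add: power2_eq_square algebra_simps)
    with t show ?thesis by (simp add: zero_le_mult_iff)
  qed
  have "((\<lambda>t. r - s + inner p (z - p) + t * ((norm (z - p))\<^sup>2 / 2)) \<longlongrightarrow>
      r - s + inner p (z - p) + 0 * ((norm (z - p))\<^sup>2 / 2)) (at_right 0)"
    by (intro tendsto_intros)
  moreover have "\<forall>\<^sub>F t in at_right 0. 0 \<le> r - s + inner p (z - p) + t * ((norm (z - p))\<^sup>2 / 2)"
    using eventually_mono[OF eventually_at_right_real[OF zero_less_one] slope] .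
  ultimately have "0 \<le> r - s + inner p (z - p) + 0 * ((norm (z - p))\<^sup>2 / 2)"
    by (intro tendsto_lowerbound) auto
  then show ?thesis by simp
qed

section \<open>Maximal monotone operators and Minty's theorem\<close>

text \<open>
  Maximality in pointwise form: a point that is monotonically related to the whole graph can be
  added to it without destroying monotonicity, hence is already there. This is how maximality
  is used throughout.
\<close>

lemma maximal_monotone_iff:
  "maximal_monotone M \<longleftrightarrow> monotone_op M \<and>
     (\<forall>x v. (\<forall>a. \<forall>u\<in>M a. 0 \<le> inner (x - a) (v - u)) \<longrightarrow> v \<in> M x)"
  (is "_ \<longleftrightarrow> _ \<and> ?closed")
proof (intro iffI conjI)
  assume max: "maximal_monotone M"
  then show mono: "monotone_op M" by (simp add: maximal_monotone_def)
  show ?closed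
  proof (intro allI impI)
    fix x v assume rel: "\<forall>a. \<forall>u\<in>M a. 0 \<le> inner (x - a) (v - u)"
    have rel': "0 \<le> inner (a - x) (u - v)" if "u \<in> M a" for a u
      using rel that inner_minus_left[of "x - a"] inner_minus_right[of "a - x" "v - u"]
      by (metis minus_diff_eq minus_minus)
    define N where "N = M(x := insert v (M x))"
    have "monotone_op N"
      using mono rel rel' unfolding monotone_op_def N_def by (auto split: if_splits)
    moreover have "\<forall>y. M y \<subseteq> N y" by (auto simp: N_def)
    ultimately have "N = M" using max by (simp add: maximal_monotone_def)
    then show "v \<in> M x" by (metis N_def fun_upd_same insertI1)
  qed
next
  assume *: "monotone_op M \<and> ?closed"
  have "N = M" if N: "monotone_op N" and sub: "\<forall>x. M x \<subseteq> N x" for N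
  proof (intro ext equalityI subsetI)
    fix x v assume "v \<in> N x"
    then have "\<forall>a. \<forall>u\<in>M a. 0 \<le> inner (x - a) (v - u)"
      using N sub unfolding monotone_op_def by blast
    with * show "v \<in> M x" by blast
  qed (use sub in auto)
  with * show "maximal_monotone M" unfolding maximal_monotone_def by blast
qed

lemma maximal_monotone_mono:
  assumes "maximal_monotone M" "u \<in> M x" "v \<in> M y"
  shows "0 \<le> inner (x - y) (u - v)"
  using assms by (auto simp: maximal_monotone_def monotone_op_def)

lemma maximal_monotone_memI:
  assumes "maximal_monotone M" "\<And>a u. u \<in> M a \<Longrightarrow> 0 \<le> inner (x - a) (v - u)"
  shows "v \<in> M x"
  using assms unfolding maximal_monotone_iff by blast

text \<open>
  The epigraph of the Fitzpatrick function of \<open>M\<close>. The function itself may take the value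
  \<open>\<infinity>\<close>, whereas its epigraph is a subset of a real Hilbert space.
\<close>

definition fitzpatrick_epigraph :: "'a::real_inner setop \<Rightarrow> (('a \<times> 'a) \<times> real) set" where
  "fitzpatrick_epigraph M =
     {((x, v), r). \<forall>a. \<forall>u\<in>M a. inner x u + inner a v - inner a u \<le> r}"

text \<open>
  Completing the product turns the defining inequality into a comparison of \<open>r\<close> with \<open>\<langle>x, v\<rangle>\<close>,
  in which the pairing that expresses monotonicity is the defect.
\<close>

lemma fitzpatrick_epigraph_iff:
  "((x, v), r) \<in> fitzpatrick_epigraph M \<longleftrightarrow>
     (\<forall>a. \<forall>u\<in>M a. inner x v - inner (x - a) (v - u) \<le> r)"
  by (simp add: fitzpatrick_epigraph_def algebra_simps)

text \<open>
  A supremum of affine functions has an intersection of half-spaces as its epigraph; closedness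
  and convexity are read off from this form.
\<close>

lemma fitzpatrick_epigraph_eq_Inter:
  "fitzpatrick_epigraph M = (\<Inter>a. \<Inter>u\<in>M a.
     {k. inner (fst k) (u, a) - snd k \<le> inner a u})"
  unfolding fitzpatrick_epigraph_def
  by (auto simp: inner_prod_def inner_commute algebra_simps)

lemma closed_fitzpatrick_epigraph: "closed (fitzpatrick_epigraph M)"
  unfolding fitzpatrick_epigraph_eq_Inter
  by (intro closed_INT ballI closed_Collect_le continuous_intros)

lemma convex_fitzpatrick_epigraph: "convex (fitzpatrick_epigraph M)"
proof -
  have "convex {k :: ('a \<times> 'a) \<times> real. inner (fst k) (u, a) - snd k \<le> inner a u}" for u a :: 'a
  proof -
    have "{k :: ('a \<times> 'a) \<times> real. inner (fst k) (u, a) - snd k \<le> inner a u}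
        = {k. inner ((u, a), -1) k \<le> inner a u}"
      by (auto simp: inner_prod_def inner_commute)
    then show ?thesis by (simp only: convex_halfspace_le)
  qed
  then show ?thesis
    unfolding fitzpatrick_epigraph_eq_Inter by (intro convex_INT)
qed

lemma graph_in_fitzpatrick_epigraph:
  assumes "monotone_op M" "v \<in> M x"
  shows "((x, v), inner x v) \<in> fitzpatrick_epigraph M"
  using assms by (auto simp: fitzpatrick_epigraph_iff monotone_op_def)

text \<open>
  If \<open>r < \<langle>x, v\<rangle>\<close>, then every defect \<open>\<langle>x - a, v - u\<rangle>\<close> is positive, so maximality puts \<open>(x, v)\<close> on the
  graph; but there the defect at \<open>(x, v)\<close> itself is zero.
\<close>

lemma fitzpatrick_ge_inner:
  assumes "maximal_monotone M" "((x, v), r) \<in> fitzpatrick_epigraph M"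
  shows "inner x v \<le> r"
proof (rule ccontr)
  assume "\<not> inner x v \<le> r"
  then have "0 \<le> inner (x - a) (v - u)" if "u \<in> M a" for a u
    using assms(2) that unfolding fitzpatrick_epigraph_iff by force
  then have "v \<in> M x" by (rule maximal_monotone_memI[OF assms(1)])
  then show False
    using assms(2) \<open>\<not> inner x v \<le> r\<close> unfolding fitzpatrick_epigraph_iff by force
qed

lemma sum_squares_plus_inner:
  fixes x v :: "'a::real_inner"
  shows "(norm x)\<^sup>2 + (norm v)\<^sup>2 + 2 * inner x v = (norm (x + v))\<^sup>2"
  by (simp add: power2_norm_eq_inner inner_add_left inner_add_right inner_commute)

lemma norm_Pair_squared: "(norm (x, v))\<^sup>2 = (norm x)\<^sup>2 + (norm v)\<^sup>2"
  by (simp add: norm_prod_def)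

text \<open>
  Minty's theorem at the origin. The regularised Fitzpatrick function is nonnegative because
  \<open>F (x, v) + (\<parallel>x\<parallel>\<^sup>2 + \<parallel>v\<parallel>\<^sup>2) / 2 \<ge> \<parallel>x + v\<parallel>\<^sup>2 / 2\<close>; the solution is read off from its minimiser.
\<close>

theorem minty_antidiagonal:
  fixes M :: "'a::{real_inner, complete_space} setop"
  assumes max: "maximal_monotone M"
  shows "\<exists>x. - x \<in> M x"
proof -
  let ?K = "fitzpatrick_epigraph M"
  have mono: "monotone_op M" using max by (simp add: maximal_monotone_def)
  \<comment> \<open>Were the graph empty, the maximality criterion would vacuously place the origin on it.\<close>
  have "\<exists>a u. u \<in> M a"
    using maximal_monotone_memI[OF max, of 0 0] by blast
  then have ne: "?K \<noteq> {}"
    using graph_in_fitzpatrick_epigraph[OF mono] by blast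
  have bdd: "0 \<le> r + (norm z)\<^sup>2 / 2" if "(z, r) \<in> ?K" for z r
  proof (cases z)
    case (Pair x v)
    then have "inner x v \<le> r"
      using fitzpatrick_ge_inner[OF max] that by blast
    moreover have "0 \<le> (norm x)\<^sup>2 + (norm v)\<^sup>2 + 2 * inner x v"
      unfolding sum_squares_plus_inner by simp
    ultimately show ?thesis
      unfolding Pair norm_Pair_squared by argo
  qed
  obtain z s where zs: "(z, s) \<in> ?K"
    and min: "\<And>z' r. (z', r) \<in> ?K \<Longrightarrow> s + (norm z)\<^sup>2 / 2 \<le> r + (norm z')\<^sup>2 / 2"
    using strongly_convex_minimizer_exists[OF convex_fitzpatrick_epigraph
        closed_fitzpatrick_epigraph ne bdd] by blast
  obtain p q where z: "z = (p, q)" by (cases z)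
  have s: "inner p q \<le> s" using fitzpatrick_ge_inner[OF max] zs z by blast
  \<comment> \<open>Both the first-order condition and \<open>F (p, q) \<ge> \<langle>p, q\<rangle>\<close> enter; the swap of coordinates in
      \<open>(- q, - p)\<close> comes from the Fitzpatrick pairing of \<open>x\<close> with \<open>u\<close> and \<open>a\<close> with \<open>v\<close>.\<close>
  have gap: "(norm (p + q))\<^sup>2 \<le> inner (- q - a) (- p - u)" if "u \<in> M a" for a u
  proof -
    have "s \<le> inner a u + inner (p, q) ((a, u) - (p, q))"
      using minimizer_variational_inequality[OF convex_fitzpatrick_epigraph zs
          graph_in_fitzpatrick_epigraph[OF mono that] min] z by simp
    then have "s + (norm p)\<^sup>2 + (norm q)\<^sup>2 \<le> inner a u + inner p a + inner q u"
      by (simp add: inner_prod_def inner_diff_right power2_norm_eq_inner)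
    moreover have "inner (- q - a) (- p - u) = inner p q + inner q u + inner p a + inner a u"
      by (simp add: inner_diff_left inner_diff_right inner_commute)
    ultimately show ?thesis
      using s sum_squares_plus_inner[of p q] by linarith
  qed
  have mem: "- p \<in> M (- q)"
    using gap by (intro maximal_monotone_memI[OF max]) (meson order_trans zero_le_power2)
  have "p + q = 0" using gap[OF mem] by simp
  then have "- q = p" by (simp add: add_eq_0_iff2)
  with mem show ?thesis by metis
qed

text \<open>
  Substitute \<open>w + c x\<close> for the argument and scale the values by the same factor \<open>c = \<surd>t\<close>. The common
  factor is what keeps the operator maximal monotone, and it makes a solution of
  \<open>- x = c u\<close> with \<open>u \<in> M (w + c x)\<close> satisfy \<open>w + c x = w - t u\<close>.
\<close>

lemma minty_scaled:
  fixes M :: "'a::{real_inner, complete_space} setop"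
  assumes max: "maximal_monotone M" and t: "t > 0"
  shows "\<exists>u. u \<in> M (w - t *\<^sub>R u)"
proof -
  define c where "c = sqrt t"
  have c: "c > 0" "c * c = t" using t by (auto simp: c_def)
  define N where "N = (\<lambda>x. (\<lambda>u. c *\<^sub>R u) ` M (w + c *\<^sub>R x))"
  have transfer: "inner (x - y) (c *\<^sub>R u - c *\<^sub>R v)
      = inner ((w + c *\<^sub>R x) - (w + c *\<^sub>R y)) (u - v)" for x y u v
    by (simp add: algebra_simps)
  have "maximal_monotone N"
    unfolding maximal_monotone_iff
  proof (intro conjI allI impI)
    show "monotone_op N"
      unfolding monotone_op_def N_def ball_simps transfer
      using maximal_monotone_mono[OF max] by blast
    fix x v assume rel: "\<forall>a. \<forall>u\<in>N a. 0 \<le> inner (x - a) (v - u)"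
    have v: "v = c *\<^sub>R ((1 / c) *\<^sub>R v)" using c by simp
    have "(1 / c) *\<^sub>R v \<in> M (w + c *\<^sub>R x)"
    proof (rule maximal_monotone_memI[OF max])
      fix a u assume u: "u \<in> M a"
      define a' where "a' = (1 / c) *\<^sub>R (a - w)"
      have a: "a = w + c *\<^sub>R a'" using c by (simp add: a'_def)
      have "0 \<le> inner (x - a') (c *\<^sub>R ((1 / c) *\<^sub>R v) - c *\<^sub>R u)"
        using rel u v unfolding N_def a by auto
      then show "0 \<le> inner (w + c *\<^sub>R x - a) ((1 / c) *\<^sub>R v - u)"
        unfolding transfer a .
    qed
    with v show "v \<in> N x" unfolding N_def by blast
  qed
  then obtain x where "- x \<in> N x" using minty_antidiagonal by blast
  then obtain u where u: "u \<in> M (w + c *\<^sub>R x)" and x: "- x = c *\<^sub>R u"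
    unfolding N_def by blast
  have "c *\<^sub>R x = - (t *\<^sub>R u)"
    using x c(2) by (metis minus_equation_iff scaleR_minus_right scaleR_scaleR)
  with u show ?thesis by (metis diff_conv_add_uminus)
qed

section \<open>Replacing the identity by a positive definite operator\<close>

lemma minty_solution_lipschitz:
  assumes max: "maximal_monotone M" and t: "t > 0"
    and u: "u \<in> M (x - t *\<^sub>R u)" and v: "v \<in> M (y - t *\<^sub>R v)"
  shows "t * norm (u - v) \<le> norm (x - y)"
proof -
  have "0 \<le> inner ((x - y) - t *\<^sub>R (u - v)) (u - v)"
    using maximal_monotone_mono[OF max u v] by (simp add: algebra_simps)
  then have "t * (norm (u - v))\<^sup>2 \<le> inner (x - y) (u - v)"
    by (simp add: inner_diff_left[of "x - y"] power2_norm_eq_inner)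
  also have "\<dots> \<le> norm (x - y) * norm (u - v)" by (rule norm_cauchy_schwarz)
  finally have "(t * norm (u - v)) * norm (u - v) \<le> norm (x - y) * norm (u - v)"
    by (simp add: power2_eq_square)
  then show ?thesis
    by (cases "norm (u - v) = 0") (auto dest: mult_right_le_imp_le)
qed

text \<open>
  With \<open>c\<close> the coercivity constant and \<open>K\<close> a bound on the norm,
  \<open>\<parallel>t x - B x\<parallel>\<^sup>2 \<le> (t\<^sup>2 - 2 t c + K\<^sup>2) \<parallel>x\<parallel>\<^sup>2\<close>, so the ratio to \<open>t\<^sup>2\<close> drops below one as soon as
  \<open>t > K\<^sup>2 / (2 c)\<close>. The choice \<open>t = K\<^sup>2 / c\<close> minimises this ratio.
\<close>

lemma damped_positive_definite_contracts:
  assumes B: "bounded_linear B" and pos: "positive_definite B"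
  obtains t q where "t > 0" "0 \<le> q" "q < 1"
    "\<And>x. norm (t *\<^sub>R x - B x) \<le> t * q * norm x"
proof -
  obtain c where c: "c > 0" and coercive: "\<And>x. c * (norm x)\<^sup>2 \<le> inner (B x) x"
    using pos unfolding positive_definite_def by blast
  obtain K0 where K0: "K0 > 0" "\<And>x. norm (B x) \<le> norm x * K0"
    using bounded_linear.pos_bounded[OF B] by blast
  \<comment> \<open>On the trivial space a norm bound can be smaller than \<open>c\<close>; enlarging it keeps \<open>q\<close> real.\<close>
  define K where "K = max K0 c"
  have K: "c \<le> K" "K > 0" using c by (auto simp: K_def)
  have bnd: "norm (B x) \<le> K * norm x" for x
    using K0(2)[of x] mult_left_mono[of K0 K "norm x"] by (simp add: K_def mult.commute)
  define t where "t = K\<^sup>2 / c"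
  define q where "q = sqrt (1 - (c / K)\<^sup>2)"
  have t: "t > 0" "t * c = K\<^sup>2" using c K by (auto simp: t_def)
  have ratio: "0 < (c / K)\<^sup>2" "(c / K)\<^sup>2 \<le> 1"
    using c K by (auto simp: power_le_one_iff)
  have q: "0 \<le> q" "q < 1" "q\<^sup>2 = 1 - (c / K)\<^sup>2"
    using ratio by (auto simp: q_def real_sqrt_lt_1_iff)
  have tq: "t\<^sup>2 * q\<^sup>2 = t\<^sup>2 - K\<^sup>2"
    using c K unfolding q(3) t_def by (simp add: field_simps power2_eq_square)
  have "norm (t *\<^sub>R x - B x) \<le> t * q * norm x" for x
  proof (rule power2_le_imp_le)
    have "(norm (t *\<^sub>R x - B x))\<^sup>2
        = t\<^sup>2 * (norm x)\<^sup>2 - 2 * t * inner (B x) x + (norm (B x))\<^sup>2"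
      by (simp only: power2_norm_eq_inner inner_diff_left inner_diff_right inner_scaleR_left
          inner_scaleR_right inner_commute[of x "B x"]) (simp add: power2_eq_square algebra_simps)
    also have "\<dots> \<le> t\<^sup>2 * (norm x)\<^sup>2 - 2 * t * (c * (norm x)\<^sup>2) + (K * norm x)\<^sup>2"
      using coercive[of x] bnd[of x] t(1) by (intro add_mono diff_mono mult_left_mono power_mono) auto
    also have "\<dots> = t\<^sup>2 * (norm x)\<^sup>2 - 2 * (t * c) * (norm x)\<^sup>2 + K\<^sup>2 * (norm x)\<^sup>2"
      by (simp add: power_mult_distrib)
    also have "\<dots> = (t\<^sup>2 - K\<^sup>2) * (norm x)\<^sup>2"
      unfolding t(2) by (simp add: algebra_simps)
    also have "\<dots> = (t * q * norm x)\<^sup>2"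
      unfolding tq[symmetric] by (simp add: power_mult_distrib)
    finally show "(norm (t *\<^sub>R x - B x))\<^sup>2 \<le> (t * q * norm x)\<^sup>2" .
    show "0 \<le> t * q * norm x" using t q by simp
  qed
  with t(1) q(1,2) show thesis by (rule that)
qed

text \<open>
  The inclusion is equivalent to \<open>u \<in> M ((x + t u - B u) - t u)\<close>, so its solutions are the fixed points of
  \<open>T\<close> below; the factor \<open>t q\<close> of \<open>t I - B\<close> and the factor \<open>1/t\<close> of Minty's solution map combine
  to the contraction constant \<open>q\<close>.
\<close>

theorem inclusion_solvable:
  fixes M :: "'a::{real_inner, complete_space} setop"
  assumes max: "maximal_monotone M" and B: "bounded_linear B" and pos: "positive_definite B"
  shows "\<exists>u. u \<in> M (x - B u)"
proof -
  interpret B: bounded_linear B by (rule B)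
  obtain t q where t: "t > 0" and q: "0 \<le> q" "q < 1"
    and contr: "\<And>y. norm (t *\<^sub>R y - B y) \<le> t * q * norm y"
    using damped_positive_definite_contracts[OF B pos] by blast
  define w where "w = (\<lambda>y. x + (t *\<^sub>R y - B y))"
  have "\<forall>y. \<exists>u. u \<in> M (w y - t *\<^sub>R u)"
    using minty_scaled[OF max t] by blast
  then obtain T where T: "\<And>y. T y \<in> M (w y - t *\<^sub>R T y)"
    by metis
  have "dist (T y) (T z) \<le> q * dist y z" for y z
  proof -
    have "w y - w z = t *\<^sub>R (y - z) - B (y - z)"
      by (simp add: w_def B.diff algebra_simps)
    then have "t * norm (T y - T z) \<le> t * (q * norm (y - z))"
      using minty_solution_lipschitz[OF max t T T, of y z] contr[of "y - z"] by simp
    with t show ?thesis by (simp add: dist_norm)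
  qed
  then have "\<exists>!u. T u = u"
    using q by (intro banach_fix_type[of q]) auto
  then obtain u where "T u = u" by blast
  then have "u \<in> M (w u - t *\<^sub>R u)" using T[of u] by simp
  then show ?thesis by (auto simp: w_def)
qed

lemma inclusion_unique:
  assumes max: "maximal_monotone M" and B: "linear B" and pos: "positive_definite B"
    and u: "u \<in> M (x - B u)" and v: "v \<in> M (x - B v)"
  shows "u = v"
proof -
  obtain c where c: "c > 0" "\<And>x. c * (norm x)\<^sup>2 \<le> inner (B x) x"
    using pos unfolding positive_definite_def by blast
  have "inner (B (u - v)) (u - v) \<le> 0"
    using maximal_monotone_mono[OF max u v] by (simp add: linear_diff[OF B] algebra_simps)
  with c(2)[of "u - v"] have "c * (norm (u - v))\<^sup>2 \<le> 0" by linarith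
  with c(1) show ?thesis by (simp add: mult_le_0_iff)
qed

lemma positive_definite_inj:
  assumes "linear E" "positive_definite E"
  shows "inj E"
  unfolding linear_injective_0[OF assms(1)]
proof (intro allI impI)
  fix x assume "E x = 0"
  then obtain c where "c > 0" "c * (norm x)\<^sup>2 \<le> 0"
    using assms(2) unfolding positive_definite_def by (metis inner_zero_left)
  then show "x = 0" by (simp add: mult_le_0_iff)
qed

lemma positive_definite_scaleR:
  assumes "positive_definite E" "l > 0"
  shows "positive_definite (\<lambda>x. l *\<^sub>R E x)"
proof -
  obtain c where "c > 0" "\<And>x. c * (norm x)\<^sup>2 \<le> inner (E x) x"
    using assms(1) unfolding positive_definite_def by blast
  with assms(2) show ?thesis
    unfolding positive_definite_def by (intro exI[of _ "l * c"]) (simp add: mult.assoc)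
qed

theorem proposition3:
  fixes E :: "'a::{real_inner, complete_space} \<Rightarrow> 'a"
    and M :: "'a setop"
    and l :: real
  assumes "bounded_linear E"
    and "positive_definite E"
    and "l > 0"
    and "maximal_monotone M"
  defines "L \<equiv> op_inv (op_plus (op_inv M) (op_scale l (op_of E)))"
    and "R \<equiv> op_scale (1 / l) (op_comp (op_inv (op_of E))
               (op_minus (op_of id) (resolvent (op_scale l (op_comp (op_of E) M)))))"
  shows "op_single_valued L \<and> op_single_valued R \<and> L = R"
proof -
  define B where "B = (\<lambda>x. l *\<^sub>R E x)"
  have B: "bounded_linear B" "positive_definite B"
    unfolding B_def using assms(1-3)
    by (auto intro: bounded_linear_const_scaleR positive_definite_scaleR)
  have linE: "linear E" using assms(1) by (rule bounded_linear.linear)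
  have L: "L x = {u. u \<in> M (x - B u)}" for x
    by (force simp: L_def B_def op_inv_def op_plus_def op_scale_def op_of_def
        intro: exI[of _ "x - l *\<^sub>R E _"])
  have R: "R x = {u. u \<in> M (x - B u)}" for x
  proof -
    have "R x = {(1 / l) *\<^sub>R y | y p u. u \<in> M p \<and> x = p + l *\<^sub>R E u \<and> E y = x - p}"
      by (fastforce simp: R_def resolvent_def op_inv_def op_plus_def op_minus_def op_comp_def
          op_scale_def op_of_def)
    also have "\<dots> = {u. u \<in> M (x - B u)}"
    proof (intro equalityI subsetI)
      fix y' assume "y' \<in> {(1 / l) *\<^sub>R y | y p u. u \<in> M p \<and> x = p + l *\<^sub>R E u \<and> E y = x - p}"
      then obtain y p u where y': "y' = (1 / l) *\<^sub>R y" and u: "u \<in> M p"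
        and x: "x = p + l *\<^sub>R E u" and "E y = x - p" by blast
      then have "E y = E (l *\<^sub>R u)" by (simp add: linear_scale[OF linE])
      then have "y = l *\<^sub>R u" using positive_definite_inj[OF linE assms(2)] by (simp add: inj_eq)
      then have "y' = u" using y' assms(3) by simp
      with u x show "y' \<in> {u. u \<in> M (x - B u)}" by (simp add: B_def)
    next
      fix u assume "u \<in> {u. u \<in> M (x - B u)}"
      then have "u \<in> M (x - B u) \<and> x = (x - B u) + l *\<^sub>R E u \<and> E (l *\<^sub>R u) = x - (x - B u)"
        by (simp add: B_def linear_scale[OF linE])
      moreover have "u = (1 / l) *\<^sub>R (l *\<^sub>R u)" using assms(3) by simp
      ultimately show "u \<in> {(1 / l) *\<^sub>R y | y p u. u \<in> M p \<and> x = p + l *\<^sub>R E u \<and> E y = x - p}"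
        by blast
    qed
    finally show ?thesis .
  qed
  have "\<exists>!u. u \<in> M (x - B u)" for x
    using inclusion_solvable[OF assms(4) B]
      inclusion_unique[OF assms(4) bounded_linear.linear[OF B(1)] B(2)] by blast
  then have "op_single_valued L" by (simp add: op_single_valued_def L)
  moreover have "L = R" by (rule ext) (simp add: L R)
  ultimately show ?thesis by simp
qed

end
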